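(* Let $N\geq 2$ and let $a_1,\dots,a_N\in\mathbb{C}$ with $\sum_{i=1}^N|a_i|^2=1$. Let $|W\rangle_{A_1A_2\cdots A_N}=a_1|10\cdots0\rangle+a_2|01\cdots0\rangle+\cdots+a_N|00\cdots1\rangle\in(\mathbb{C}^2)^{\otimes N}$ be the corresponding $N$-qubit $W$-class state. Then its squared $N$-partite concurrence is $$\mathcal{C}_N^2(|W\rangle_{A_1A_2\cdots A_N})=4\sum_{1\leq i<j\leq N}|a_i|^2|a_j|^2 .$$
   Context: $\{|0\rangle,|1\rangle\}$ is the standard orthonormal basis of $\mathbb{C}^2$; the coefficient $a_i$ multiplies the product basis vector with $|1\rangle$ in the $i$-th tensor factor and $|0\rangle$ in all the others. For a unit vector $|\psi\rangle\in H_1\otimes\cdots\otimes H_N$ (finite-dimensional complex Hilbert spaces), the $N$-partite concurrence is $$\mathcal{C}_N(|\psi\rangle)=2^{1-\frac N2}\sqrt{(2^N-2)-\sum_{\alpha}\mathrm{Tr}(\rho_\alpha^2)},$$ where $\alpha$ runs over all $2^N-2$ subsets $\emptyset\neq\alpha\subsetneq\{1,\dots,N\}$ and $\rho_\alpha$ is the reduced density matrix of $|\psi\rangle\langle\psi|$ on the subsystems in $\alpha$ (partial trace over the subsystems not in $\alpha$). *)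

theory Defs
  imports "HOL-Analysis.Finite_Product_Measure"
begin

text \<open>
  Subsystem \<open>i\<close> is \<open>\<complex>\<close> to the power \<open>d i\<close> with standard basis labelled by \<open>{..<d i}\<close>. For a
  finite set \<open>A\<close> of subsystems, the product basis of the tensor product over \<open>A\<close> is labelled by
  \<open>basis_labels d A\<close>. Vectors and operators are given by their coordinates with respect to this
  basis; their values at arguments outside \<open>basis_labels d A\<close> carry no meaning.
\<close>

type_synonym label = "nat \<Rightarrow> nat"
type_synonym state = "label \<Rightarrow> complex"
type_synonym operator = "label \<Rightarrow> label \<Rightarrow> complex"

definition basis_labels :: "(nat \<Rightarrow> nat) \<Rightarrow> nat set \<Rightarrow> label set" where
  "basis_labels d A = (\<Pi>\<^sub>E i\<in>A. {..<d i})"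

definition ket :: "nat \<Rightarrow> nat \<Rightarrow> complex" where
  "ket b = (\<lambda>x. if x = b then 1 else 0)"

definition tensor :: "nat set \<Rightarrow> (nat \<Rightarrow> nat \<Rightarrow> complex) \<Rightarrow> state" where
  "tensor A v = (\<lambda>x. \<Prod>i\<in>A. v i (x i))"

definition ket_bra :: "state \<Rightarrow> operator" where
  "ket_bra \<psi> = (\<lambda>x y. \<psi> x * cnj (\<psi> y))"

definition op_mult :: "(nat \<Rightarrow> nat) \<Rightarrow> nat set \<Rightarrow> operator \<Rightarrow> operator \<Rightarrow> operator" where
  "op_mult d A S T = (\<lambda>x y. \<Sum>z\<in>basis_labels d A. S x z * T z y)"

definition op_trace :: "(nat \<Rightarrow> nat) \<Rightarrow> nat set \<Rightarrow> operator \<Rightarrow> complex" where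
  "op_trace d A S = (\<Sum>x\<in>basis_labels d A. S x x)"

text \<open>
  For disjoint \<open>A\<close> and \<open>B\<close>, this maps an operator on the subsystems \<open>A \<union> B\<close> to an operator on
  the subsystems \<open>A\<close>, tracing out \<open>B\<close>.
\<close>

definition partial_trace :: "(nat \<Rightarrow> nat) \<Rightarrow> nat set \<Rightarrow> nat set \<Rightarrow> operator \<Rightarrow> operator" where
  "partial_trace d A B S =
     (\<lambda>x y. \<Sum>z\<in>basis_labels d B. S (merge A B (x, z)) (merge A B (y, z)))"

definition reduced_density :: "(nat \<Rightarrow> nat) \<Rightarrow> nat \<Rightarrow> nat set \<Rightarrow> state \<Rightarrow> operator" where
  "reduced_density d N \<alpha> \<psi> = partial_trace d \<alpha> ({1..N} - \<alpha>) (ket_bra \<psi>)"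

definition purity :: "(nat \<Rightarrow> nat) \<Rightarrow> nat \<Rightarrow> nat set \<Rightarrow> state \<Rightarrow> complex" where
  "purity d N \<alpha> \<psi> =
     op_trace d \<alpha> (op_mult d \<alpha> (reduced_density d N \<alpha> \<psi>) (reduced_density d N \<alpha> \<psi>))"

text \<open>The purity is real, so nothing is lost by taking \<open>Re\<close> in the concurrence.\<close>

lemma purity_in_Reals: "purity d N \<alpha> \<psi> \<in> \<real>"
proof -
  let ?R = "reduced_density d N \<alpha> \<psi>"
  have "?R y x = cnj (?R x y)" for x y
    by (simp add: reduced_density_def partial_trace_def ket_bra_def mult.commute)
  then have "?R x y * ?R y x = complex_of_real ((cmod (?R x y))\<^sup>2)" for x y
    by (metis complex_norm_square)
  then show ?thesis
    unfolding purity_def op_trace_def op_mult_def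
    by (intro sum_in_Reals) (metis Reals_of_real)
qed

definition concurrence :: "(nat \<Rightarrow> nat) \<Rightarrow> nat \<Rightarrow> state \<Rightarrow> real" where
  "concurrence d N \<psi> =
     2 powr (1 - real N / 2) *
     sqrt ((2 ^ N - 2) - (\<Sum>\<alpha> | \<alpha> \<noteq> {} \<and> \<alpha> \<subset> {1..N}. Re (purity d N \<alpha> \<psi>)))"

definition W_state :: "nat \<Rightarrow> (nat \<Rightarrow> complex) \<Rightarrow> state" where
  "W_state N a =
     (\<lambda>x. \<Sum>i=1..N. a i * tensor {1..N} (\<lambda>j. if j = i then ket 1 else ket 0) x)"

end

theory Submission imports Defs begin

text \<open>
  Write \<open>p\<close> and \<open>q\<close> for the sums of \<open>|a\<^sub>i|\<^sup>2\<close> over a set \<open>\<alpha>\<close> of qubits and over its complement.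
  Across this bipartition the state is \<open>w\<^sub>\<alpha> \<otimes> 0 + 0 \<otimes> w\<^sub>\<beta>\<close>, where \<open>w\<close> denotes the unnormalised
  W-vectors and \<open>0\<close> the vacuum vectors. As \<open>w\<^sub>\<alpha>\<close> is orthogonal to the vacuum, \<open>\<rho>\<^sub>\<alpha>\<close> has
  purity \<open>p\<^sup>2 + q\<^sup>2\<close>, so that \<open>1 - Tr \<rho>\<^sub>\<alpha>\<^sup>2 = 2pq\<close>. This vanishes for the two
  trivial subsets, and summing \<open>pq\<close> over all subsets counts each pair \<open>i < j\<close> exactly \<open>2\<^sup>N\<^sup>-\<^sup>1\<close> times.
\<close>

abbreviation (input) qubits :: "nat \<Rightarrow> nat" where
  "qubits \<equiv> \<lambda>_. 2"

definition inner_on :: "(nat \<Rightarrow> nat) \<Rightarrow> nat set \<Rightarrow> state \<Rightarrow> state \<Rightarrow> complex" where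
  "inner_on d A u v = (\<Sum>x\<in>basis_labels d A. u x * cnj (v x))"

text \<open>The index \<open>i\<close> may lie outside \<open>A\<close>, so that a single-excitation
  vector on a disjoint union factors into vectors of this same form on both parts.\<close>

definition one_excitation :: "nat set \<Rightarrow> nat \<Rightarrow> state" where
  "one_excitation A i = tensor A (\<lambda>j. if j = i then ket 1 else ket 0)"

definition vacuum :: "nat set \<Rightarrow> state" where
  "vacuum A = tensor A (\<lambda>_. ket 0)"

definition W_vector :: "nat set \<Rightarrow> (nat \<Rightarrow> complex) \<Rightarrow> state" where
  "W_vector A a = (\<lambda>x. \<Sum>i\<in>A. a i * one_excitation A i x)"

lemma W_state_eq: "W_state N a = W_vector {1..N} a"
  by (simp add: W_state_def W_vector_def one_excitation_def)

lemma inner_on_tensor: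
  assumes "finite A"
  shows "inner_on d A (tensor A u) (tensor A v) = (\<Prod>i\<in>A. \<Sum>b<d i. u i b * cnj (v i b))"
  using assms
  by (simp add: inner_on_def tensor_def basis_labels_def prod_sum_PiE prod.distrib)

lemma cnj_inner_on: "cnj (inner_on d A u v) = inner_on d A v u"
  by (simp add: inner_on_def mult.commute)

lemma inner_on_vacuum: "finite A \<Longrightarrow> inner_on qubits A (vacuum A) (vacuum A) = 1"
  by (simp add: vacuum_def inner_on_tensor ket_def numeral_2_eq_2)

lemma inner_on_one_excitation_vacuum:
  assumes "finite A" "i \<in> A"
  shows "inner_on qubits A (one_excitation A i) (vacuum A) = 0"
  using assms
  by (auto simp: one_excitation_def vacuum_def inner_on_tensor ket_def numeral_2_eq_2)

lemma inner_on_one_excitation: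
  assumes "finite A" "i \<in> A" "j \<in> A"
  shows "inner_on qubits A (one_excitation A i) (one_excitation A j) = (if i = j then 1 else 0)"
  \<comment> \<open>If \<open>i = j\<close>, every factor is 1; otherwise the factor at site
    \<open>i\<close> pairs \<open>ket 1\<close> with \<open>ket 0\<close> and is 0.\<close>
  using assms
  by (auto simp: one_excitation_def inner_on_tensor ket_def numeral_2_eq_2 intro!: prod.neutral bexI[of _ i])

lemma inner_on_W_vector:
  "inner_on d A (W_vector A a) v = (\<Sum>i\<in>A. a i * inner_on d A (one_excitation A i) v)"
  unfolding inner_on_def W_vector_def sum_distrib_right sum_distrib_left
  by (subst sum.swap) (simp add: mult.assoc)

lemma inner_on_W_vector_vacuum:
  "finite A \<Longrightarrow> inner_on qubits A (W_vector A a) (vacuum A) = 0"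
  by (simp add: inner_on_W_vector inner_on_one_excitation_vacuum)

lemma inner_on_W_vector_W_vector:
  assumes "finite A"
  shows "inner_on qubits A (W_vector A a) (W_vector A a) = of_real (\<Sum>i\<in>A. (cmod (a i))\<^sup>2)"
proof -
  have "inner_on qubits A (one_excitation A i) (W_vector A a) = cnj (a i)" if "i \<in> A" for i
  proof -
    have "inner_on qubits A (one_excitation A i) (W_vector A a)
        = cnj (\<Sum>j\<in>A. a j * (if i = j then 1 else 0))"
      \<comment> \<open>\<open>inner_on_W_vector\<close> expands the first argument only; conjugate
        symmetry moves the W-vector there.\<close>
      using assms that
      by (subst cnj_inner_on[symmetric])
        (simp add: inner_on_W_vector inner_on_one_excitation eq_commute del: cnj_sum cong: if_cong)
    also have "\<dots> = cnj (a i)"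
      using assms that by (simp add: if_distrib cong: if_cong)
    finally show ?thesis .
  qed
  then show ?thesis
    by (subst inner_on_W_vector) (simp add: complex_norm_square[symmetric])
qed

lemma tensor_merge:
  assumes "finite A" "finite B" "A \<inter> B = {}"
  shows "tensor (A \<union> B) v (merge A B (x, z)) = tensor A v x * tensor B v z"
proof -
  have "(\<Prod>i\<in>B. v i (merge A B (x, z) i)) = (\<Prod>i\<in>B. v i (z i))"
    using assms(3) by (intro prod.cong) (auto simp: merge_def)
  moreover have "(\<Prod>i\<in>A. v i (merge A B (x, z) i)) = (\<Prod>i\<in>A. v i (x i))"
    by (intro prod.cong) (auto simp: merge_def)
  ultimately show ?thesis
    using assms by (simp add: tensor_def prod.union_disjoint)
qed

lemma one_excitation_notin: "i \<notin> A \<Longrightarrow> one_excitation A i = vacuum A"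
  by (auto simp: one_excitation_def vacuum_def tensor_def intro!: ext prod.cong)

text \<open>Each excitation sits in exactly one of the disjoint parts, and the other part is then in
  the vacuum.\<close>

lemma W_vector_merge:
  assumes "finite A" "finite B" "A \<inter> B = {}"
  shows "W_vector (A \<union> B) a (merge A B (x, z))
    = W_vector A a x * vacuum B z + vacuum A x * W_vector B a z"
proof -
  have split: "one_excitation (A \<union> B) i (merge A B (x, z))
      = one_excitation A i x * one_excitation B i z" for i
    using assms by (simp add: one_excitation_def tensor_merge)
  have "(\<Sum>i\<in>A. a i * (one_excitation A i x * one_excitation B i z))
      = (\<Sum>i\<in>A. a i * one_excitation A i x * vacuum B z)"
    using assms(3) by (intro sum.cong) (auto simp: one_excitation_notin disjoint_iff)
  moreover have "(\<Sum>i\<in>B. a i * (one_excitation A i x * one_excitation B i z))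
      = (\<Sum>i\<in>B. vacuum A x * (a i * one_excitation B i z))"
    using assms(3) by (intro sum.cong) (auto simp: one_excitation_notin disjoint_iff_not_equal)
  ultimately show ?thesis
    using assms
    by (simp add: W_vector_def split sum.union_disjoint sum_distrib_left sum_distrib_right)
qed

text \<open>The two-term splitting gives four terms, each weighted by an inner product on
  \<open>B\<close>: the mixed weights vanish by orthogonality, the others are 1 and the squared norm
  of the W-vector on \<open>B\<close>.\<close>

lemma partial_trace_W_vector:
  assumes "finite A" "finite B" "A \<inter> B = {}"
  shows "partial_trace qubits A B (ket_bra (W_vector (A \<union> B) a)) x y
    = W_vector A a x * cnj (W_vector A a y)
      + of_real (\<Sum>i\<in>B. (cmod (a i))\<^sup>2) * (vacuum A x * cnj (vacuum A y))"
proof -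
  let ?w = "W_vector A a" and ?o = "vacuum A" and ?w' = "W_vector B a" and ?o' = "vacuum B"
  have "partial_trace qubits A B (ket_bra (W_vector (A \<union> B) a)) x y
      = ?w x * cnj (?w y) * inner_on qubits B ?o' ?o' + ?w x * cnj (?o y) * inner_on qubits B ?o' ?w'
        + ?o x * cnj (?w y) * inner_on qubits B ?w' ?o' + ?o x * cnj (?o y) * inner_on qubits B ?w' ?w'"
    by (simp add: partial_trace_def ket_bra_def W_vector_merge[OF assms] inner_on_def
        sum_distrib_left sum.distrib algebra_simps)
  moreover have "inner_on qubits B ?o' ?w' = 0"
    using cnj_inner_on[of qubits B ?w' ?o'] inner_on_W_vector_vacuum[OF assms(2), of a] by simp
  ultimately show ?thesis
    using assms
    by (simp add: inner_on_vacuum inner_on_W_vector_vacuum inner_on_W_vector_W_vector del: of_real_sum)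
qed

text \<open>The trace of a product of two rank-one operators is a product of two inner products.
  With a W-vector for \<open>u\<close> and the vacuum for \<open>v\<close>, the mixed term
  vanishes.\<close>

lemma trace_square_rank_two:
  fixes c :: complex
  shows "op_trace d A (op_mult d A (\<lambda>x y. u x * cnj (u y) + c * (v x * cnj (v y)))
      (\<lambda>x y. u x * cnj (u y) + c * (v x * cnj (v y))))
    = (inner_on d A u u)\<^sup>2 + 2 * c * (inner_on d A u v * inner_on d A v u)
      + c\<^sup>2 * (inner_on d A v v)\<^sup>2"
proof -
  let ?L = "basis_labels d A"
  have product: "inner_on d A f g * inner_on d A h k
      = (\<Sum>x\<in>?L. \<Sum>y\<in>?L. f x * cnj (g x) * (h y * cnj (k y)))" for f g h k
    by (simp add: inner_on_def sum_product)
  \<comment> \<open>As double sums, the two mixed terms differ in the order of their factors; using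
    both orders makes the two expansions agree term by term.\<close>
  have "inner_on d A u v * inner_on d A v u = inner_on d A v u * inner_on d A u v"
    by simp
  then have "2 * c * (inner_on d A u v * inner_on d A v u)
      = c * (inner_on d A u v * inner_on d A v u) + c * (inner_on d A v u * inner_on d A u v)"
    by simp
  then show ?thesis
    unfolding op_trace_def op_mult_def power2_eq_square product
    by (simp add: sum_distrib_left sum.distrib algebra_simps)
qed

lemma purity_W_state:
  assumes "\<alpha> \<subseteq> {1..N}"
  shows "purity qubits N \<alpha> (W_state N a)
    = of_real ((\<Sum>i\<in>\<alpha>. (cmod (a i))\<^sup>2)\<^sup>2 + (\<Sum>i\<in>{1..N} - \<alpha>. (cmod (a i))\<^sup>2)\<^sup>2)"
proof -
  let ?B = "{1..N} - \<alpha>"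
  have fin: "finite \<alpha>" "finite ?B" "\<alpha> \<inter> ?B = {}"
    using assms finite_subset by auto
  have union: "{1..N} = \<alpha> \<union> ?B"
    using assms by auto
  have "reduced_density qubits N \<alpha> (W_state N a)
      = (\<lambda>x y. W_vector \<alpha> a x * cnj (W_vector \<alpha> a y)
        + of_real (\<Sum>i\<in>?B. (cmod (a i))\<^sup>2) * (vacuum \<alpha> x * cnj (vacuum \<alpha> y)))"
    unfolding reduced_density_def W_state_eq
    using partial_trace_W_vector[OF fin, of a] union by (intro ext) metis
  then show ?thesis
    unfolding purity_def using fin
    by (simp add: trace_square_rank_two inner_on_vacuum inner_on_W_vector_vacuum
        inner_on_W_vector_W_vector del: of_real_sum)
qed

lemma sum_Pow_insert:
  assumes "finite S" "s \<notin> S"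
  shows "(\<Sum>X\<in>Pow (insert s S). f X) = (\<Sum>X\<in>Pow S. f X) + (\<Sum>X\<in>Pow S. f (insert s X))"
proof -
  have "inj_on (insert s) (Pow S)"
    using assms(2) by (auto simp: inj_on_def)
  moreover have "Pow S \<inter> insert s ` Pow S = {}"
    using assms(2) by auto
  ultimately show ?thesis
    using assms(1) by (simp add: Pow_insert sum.union_disjoint sum.reindex)
qed

text \<open>For distinct \<open>i\<close> and \<open>j\<close> in \<open>S\<close>, a quarter of all
  \<open>X\<close> have \<open>i \<in> X\<close> and \<open>j \<in> S - X\<close>; for
  \<open>i = j\<close> none do. The factor 4 avoids the exponent \<open>card S - 2\<close>.\<close>

lemma sum_Pow_cut:
  fixes P :: "'a \<Rightarrow> real"
  assumes "finite S"
  shows "4 * (\<Sum>X\<in>Pow S. sum P X * sum P (S - X)) = 2 ^ card S * ((sum P S)\<^sup>2 - (\<Sum>i\<in>S. (P i)\<^sup>2))"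
  using assms
proof (induction S)
  case empty
  then show ?case by simp
next
  case (insert s S)
  have out: "sum P X * sum P (insert s S - X) = sum P X * sum P (S - X) + P s * sum P X"
    and in': "sum P (insert s X) * sum P (insert s S - insert s X)
        = sum P X * sum P (S - X) + P s * sum P (S - X)" if "X \<in> Pow S" for X
  proof -
    have X: "finite X" "s \<notin> X" and "insert s S - X = insert s (S - X)" "insert s S - insert s X = S - X"
      using that insert.hyps finite_subset by auto
    then show "sum P X * sum P (insert s S - X) = sum P X * sum P (S - X) + P s * sum P X"
      and "sum P (insert s X) * sum P (insert s S - insert s X)
        = sum P X * sum P (S - X) + P s * sum P (S - X)"
      using insert.hyps by (simp_all add: algebra_simps)
  qed
  \<comment> \<open>The extra terms with \<open>s\<close> outside and with \<open>s\<close> inside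
    the subset combine, for each \<open>X\<close>, to \<open>P s * sum P S\<close>.\<close>
  have "sum P X + sum P (S - X) = sum P S" if "X \<in> Pow S" for X
    using that insert.hyps sum.subset_diff[of X S P] by auto
  then have "(\<Sum>X\<in>Pow S. sum P X + sum P (S - X)) = 2 ^ card S * sum P S"
    using insert.hyps by (simp add: card_Pow)
  then have "(\<Sum>X\<in>Pow (insert s S). sum P X * sum P (insert s S - X))
      = 2 * (\<Sum>X\<in>Pow S. sum P X * sum P (S - X)) + P s * (2 ^ card S * sum P S)"
    by (simp only: sum_Pow_insert[OF insert.hyps] sum.cong[OF refl out] sum.cong[OF refl in'])
      (simp add: sum.distrib flip: sum_distrib_left distrib_left)
  then show ?case
    using insert by (simp add: power2_eq_square algebra_simps)
qed

lemma square_sum_minus_sum_squares: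
  fixes P :: "nat \<Rightarrow> real"
  shows "(\<Sum>i=1..N. P i)\<^sup>2 - (\<Sum>i=1..N. (P i)\<^sup>2) = 2 * (\<Sum>i=1..N. \<Sum>j\<in>{i<..N}. P i * P j)"
proof (induction N)
  case (Suc N)
  \<comment> \<open>Passing to \<open>Suc N\<close> adds the column \<open>j = Suc N\<close>; the
    row \<open>i = Suc N\<close> is empty.\<close>
  have "{i<..Suc N} = insert (Suc N) {i<..N}" if "i \<in> {1..N}" for i
    using that by auto
  then have "(\<Sum>i=1..N. \<Sum>j\<in>{i<..Suc N}. P i * P j)
      = (\<Sum>i=1..N. P i * P (Suc N) + (\<Sum>j\<in>{i<..N}. P i * P j))"
    by (intro sum.cong) auto
  then show ?case
    using Suc by (simp add: power2_eq_square algebra_simps sum.distrib sum_distrib_left)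
qed simp

theorem theorem1:
  fixes N :: nat and a :: "nat \<Rightarrow> complex"
  assumes "N \<ge> 2"
    and "(\<Sum>i=1..N. (cmod (a i))\<^sup>2) = 1"
  shows "(concurrence (\<lambda>_. 2) N (W_state N a))\<^sup>2 =
    4 * (\<Sum>i=1..N. \<Sum>j\<in>{i<..N}. (cmod (a i))\<^sup>2 * (cmod (a j))\<^sup>2)"
proof -
  let ?S = "{1..N}"
  let ?P = "\<lambda>i. (cmod (a i))\<^sup>2"
  let ?Q = "\<lambda>\<alpha>. Re (purity (\<lambda>_. 2) N \<alpha> (W_state N a))"
  let ?T = "\<Sum>i=1..N. \<Sum>j\<in>{i<..N}. ?P i * ?P j"
  have gap: "1 - ?Q \<alpha> = 2 * (sum ?P \<alpha> * sum ?P (?S - \<alpha>))" if "\<alpha> \<in> Pow ?S" for \<alpha>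
  proof -
    have "?Q \<alpha> = (sum ?P \<alpha>)\<^sup>2 + (sum ?P (?S - \<alpha>))\<^sup>2"
      using that purity_W_state[of \<alpha> N a] by (metis Pow_iff Re_complex_of_real)
    \<comment> \<open>Normalisation enters here: 1 is the square of the sum of the two weights, so
      only twice their product survives.\<close>
    moreover have "sum ?P (?S - \<alpha>) = 1 - sum ?P \<alpha>"
      using that assms(2) sum.subset_diff[of \<alpha> ?S ?P] by auto
    ultimately show ?thesis
      by (simp only:) (simp add: power2_eq_square algebra_simps)
  qed
  have proper: "{\<alpha>. \<alpha> \<noteq> {} \<and> \<alpha> \<subset> ?S} = Pow ?S - {{}, ?S}"
    by auto
  have "card (Pow ?S - {{}, ?S}) = 2 ^ N - 2"
    using assms(1) by (subst card_Diff_subset) (auto simp: card_Pow)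
  \<comment> \<open>The cardinality is a natural number; this bound lets the difference
    \<open>2 ^ N - 2\<close> pass to the reals without truncation.\<close>
  moreover have "(2::nat) \<le> 2 ^ N"
    using power_increasing[of 1 N "2::nat"] assms(1) by simp
  ultimately have "(2 ^ N - 2) - (\<Sum>\<alpha> | \<alpha> \<noteq> {} \<and> \<alpha> \<subset> ?S. ?Q \<alpha>)
      = (\<Sum>\<alpha>\<in>Pow ?S - {{}, ?S}. 1 - ?Q \<alpha>)"
    unfolding proper by (simp add: sum_subtractf of_nat_diff)
  also have "\<dots> = (\<Sum>\<alpha>\<in>Pow ?S. 1 - ?Q \<alpha>)"
    by (rule sum.mono_neutral_left) (auto simp: gap)
  also have "\<dots> = 2 * (\<Sum>\<alpha>\<in>Pow ?S. sum ?P \<alpha> * sum ?P (?S - \<alpha>))"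
    by (simp add: gap sum_distrib_left)
  also have "\<dots> = 2 ^ N * ?T"
    using sum_Pow_cut[of ?S ?P] square_sum_minus_sum_squares[of ?P N] by simp
  finally have radicand: "(2 ^ N - 2) - (\<Sum>\<alpha> | \<alpha> \<noteq> {} \<and> \<alpha> \<subset> ?S. ?Q \<alpha>) = 2 ^ N * ?T" .
  \<comment> \<open>Nonnegativity of the radicand lets squaring undo \<open>sqrt\<close>; the
    squared prefactor, 4 divided by \<open>2 ^ N\<close>, then cancels the power of 2.\<close>
  have "?T \<ge> 0"
    by (intro sum_nonneg) simp
  moreover have "(2 powr (1 - real N / 2))\<^sup>2 * 2 ^ N = (4::real)"
    by (simp add: powr_realpow[symmetric] power2_eq_square flip: powr_add)
  ultimately show ?thesis
    unfolding concurrence_def radicand by (simp add: power_mult_distrib)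
qed

end
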